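(* Let $\{r,s,t\}=\{1,2,3\}$, let $F=(f_1,f_2,f_3):\Omega\subset\mathbb R^3\to\mathbb R^3$ be differentiable in the sense of Fréchet over an open set $\Omega$, and let $\mathbb A=\mathbb A^3_{r,s}(p_1,p_2)$. Then the components of $F$ satisfy on $\Omega$ the equations $$\begin{array}{lll} \frac{\partial f_r}{\partial x_s}=0,&\frac{\partial f_s}{\partial x_r}=0,&\frac{\partial f_s}{\partial x_t}=p_1\frac{\partial f_t}{\partial x_s},\\[4pt] \frac{\partial f_r}{\partial x_t}=0,&\frac{\partial f_t}{\partial x_r}=0,&\frac{\partial f_t}{\partial x_t}=\frac{\partial f_s}{\partial x_s}+p_2\frac{\partial f_t}{\partial x_s} \end{array}$$ if and only if $F$ is $\mathbb A$-algebrizable.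
   Context: For real $p_1,p_2$, $\mathbb A^3_{r,s}(p_1,p_2)$ denotes $\mathbb R^3$ (canonical basis $e_1,e_2,e_3$) with the commutative associative product given by $e_re_r=e_r$, $e_re_s=e_re_t=0$, $e_se_s=e_s$, $e_se_t=e_t$, $e_te_t=p_1e_s+p_2e_t$; its unit is $e=e_r+e_s$. $F$ is $\mathbb A$-algebrizable on $\Omega$ if there is a function $F':\Omega\to\mathbb R^3$ with $\lim_{\xi\to0}|F(w+\xi)-F(w)-F'(w)\xi|/|\xi|=0$ for all $w\in\Omega$, where $F'(w)\xi$ is the product in $\mathbb A$. *)

theory Defs
  imports "HOL-Analysis.Analysis"
begin

text \<open>
  In the index type \<^typ>\<open>3\<close> the numeral 3 equals 0, so \<open>{1, 2, 3}\<close> is all of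
  \<^typ>\<open>3\<close>.  The index \<open>t\<close>, which is determined by \<open>r\<close> and \<open>s\<close> when
  \<open>{r, s, t} = {1, 2, 3}\<close>, is passed explicitly below.
\<close>

definition A3_basis_mult :: "3 \<Rightarrow> 3 \<Rightarrow> 3 \<Rightarrow> real \<Rightarrow> real \<Rightarrow> 3 \<Rightarrow> 3 \<Rightarrow> real ^ 3" where
  "A3_basis_mult r s t p1 p2 i j =
    (if i = r \<and> j = r then axis r 1
     else if i = s \<and> j = s then axis s 1
     else if (i = s \<and> j = t) \<or> (i = t \<and> j = s) then axis t 1
     else if i = t \<and> j = t then p1 *\<^sub>R axis s 1 + p2 *\<^sub>R axis t 1
     else 0)"

definition A3_mult :: "3 \<Rightarrow> 3 \<Rightarrow> 3 \<Rightarrow> real \<Rightarrow> real \<Rightarrow> real ^ 3 \<Rightarrow> real ^ 3 \<Rightarrow> real ^ 3" where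
  "A3_mult r s t p1 p2 x y =
    (\<Sum>i\<in>UNIV. \<Sum>j\<in>UNIV. (x $ i * y $ j) *\<^sub>R A3_basis_mult r s t p1 p2 i j)"

definition algebrizable_on ::
    "(real ^ 3 \<Rightarrow> real ^ 3 \<Rightarrow> real ^ 3) \<Rightarrow> (real ^ 3 \<Rightarrow> real ^ 3) \<Rightarrow> (real ^ 3) set \<Rightarrow> bool" where
  "algebrizable_on mul F \<Omega> \<longleftrightarrow>
    (\<exists>F' :: real ^ 3 \<Rightarrow> real ^ 3. \<forall>w\<in>\<Omega>.
      ((\<lambda>\<xi>. norm (F (w + \<xi>) - F w - mul (F' w) \<xi>) / norm \<xi>) \<longlongrightarrow> 0) (at 0))"

text \<open>
  \<open>pderiv_comp F i j w\<close> is the partial derivative at \<open>w\<close> of the \<open>i\<close>-th component of \<open>F\<close> with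
  respect to the \<open>j\<close>-th variable.  It is meaningful only where that derivative exists, in
  particular wherever \<open>F\<close> is differentiable.
\<close>

definition pderiv_comp :: "(real ^ 3 \<Rightarrow> real ^ 3) \<Rightarrow> 3 \<Rightarrow> 3 \<Rightarrow> real ^ 3 \<Rightarrow> real" where
  "pderiv_comp F i j w = deriv (\<lambda>u. F (w + u *\<^sub>R axis j 1) $ i) 0"

lemma index3_distinct:
  fixes r s t :: 3
  assumes "{r, s, t} = {1, 2, 3}"
  shows "r \<noteq> s" "r \<noteq> t" "s \<noteq> t"
proof -
  have "card {r, s, t} = 3"
    unfolding assms UNIV_3[symmetric] by simp
  then show "r \<noteq> s" "r \<noteq> t" "s \<noteq> t"
    by (auto simp: card_insert_if split: if_splits)
qed

lemma A3_mult_components: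
  assumes "{r, s, t} = {1, 2, 3}"
  shows "A3_mult r s t p1 p2 x y $ r = x $ r * y $ r"
    and "A3_mult r s t p1 p2 x y $ s = x $ s * y $ s + p1 * (x $ t * y $ t)"
    and "A3_mult r s t p1 p2 x y $ t = x $ s * y $ t + x $ t * y $ s + p2 * (x $ t * y $ t)"
proof -
  note d = index3_distinct[OF assms]
  have U: "(UNIV :: 3 set) = {r, s, t}"
    using assms UNIV_3 by simp
  have sum3: "(\<Sum>i\<in>UNIV. f i) = f r + f s + f t" for f :: "3 \<Rightarrow> real ^ 3"
    unfolding U using d by (simp add: add.assoc)
  have nth: "axis i (1 :: real) $ j = (if j = i then 1 else 0)" for i j :: 3
    by (simp add: axis_def)
  note b = A3_basis_mult_def[of r s t p1 p2]
  have basis: "A3_basis_mult r s t p1 p2 r r = axis r 1"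
    "A3_basis_mult r s t p1 p2 r s = 0" "A3_basis_mult r s t p1 p2 s r = 0"
    "A3_basis_mult r s t p1 p2 r t = 0" "A3_basis_mult r s t p1 p2 t r = 0"
    "A3_basis_mult r s t p1 p2 s s = axis s 1"
    "A3_basis_mult r s t p1 p2 s t = axis t 1" "A3_basis_mult r s t p1 p2 t s = axis t 1"
    "A3_basis_mult r s t p1 p2 t t = p1 *\<^sub>R axis s 1 + p2 *\<^sub>R axis t 1"
    unfolding b using d by auto
  show "A3_mult r s t p1 p2 x y $ r = x $ r * y $ r"
    "A3_mult r s t p1 p2 x y $ s = x $ s * y $ s + p1 * (x $ t * y $ t)"
    "A3_mult r s t p1 p2 x y $ t = x $ s * y $ t + x $ t * y $ s + p2 * (x $ t * y $ t)"
    unfolding A3_mult_def sum3 basis using d by (simp_all add: nth)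
qed

lemma A3_vec_eq_iff:
  fixes x y :: "real ^ 3"
  assumes "{r, s, t} = {1, 2, 3}"
  shows "x = y \<longleftrightarrow> x $ r = y $ r \<and> x $ s = y $ s \<and> x $ t = y $ t"
proof -
  have U: "(UNIV :: 3 set) = {r, s, t}"
    using assms UNIV_3 by simp
  have "x = y \<longleftrightarrow> (\<forall>i\<in>UNIV. x $ i = y $ i)"
    by (simp add: vec_eq_iff)
  then show ?thesis
    unfolding U by simp
qed

lemma A3_mult_commute:
  assumes "{r, s, t} = {1, 2, 3}"
  shows "A3_mult r s t p1 p2 x y = A3_mult r s t p1 p2 y x"
  by (simp add: A3_vec_eq_iff[OF assms] A3_mult_components[OF assms] algebra_simps)

lemma A3_mult_assoc:
  assumes "{r, s, t} = {1, 2, 3}"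
  shows "A3_mult r s t p1 p2 (A3_mult r s t p1 p2 x y) z =
    A3_mult r s t p1 p2 x (A3_mult r s t p1 p2 y z)"
  by (simp add: A3_vec_eq_iff[OF assms] A3_mult_components[OF assms] algebra_simps)

lemma A3_mult_unit:
  assumes "{r, s, t} = {1, 2, 3}"
  shows "A3_mult r s t p1 p2 (axis r 1 + axis s 1) x = x"
  using index3_distinct[OF assms] index3_distinct[OF assms, symmetric]
  by (simp add: A3_vec_eq_iff[OF assms] A3_mult_components[OF assms] axis_def)

end

theory Submission
  imports Defs
begin

text \<open>
  The limit in the definition of algebrizability says that \<open>F\<close> is Frechet differentiable at \<open>w\<close>
  and that its differential is the multiplication by \<open>F' w\<close>, since multiplication by a fixed
  element is bounded and linear.
  Since the differential is unique, the theorem splits into pointwise statements: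
  \<open>F\<close> is algebrizable on \<open>\<Omega>\<close> iff at each point of \<open>\<Omega>\<close> the Jacobian matrix lies in the
  regular representation of the algebra (\<open>algebrizable_on_iff_deriv_A3_mult\<close>).

  What remains is linear algebra (\<open>linear_eq_A3_mult_iff\<close>).  A linear map \<open>D\<close> that is
  multiplication by \<open>a\<close> must have \<open>a = D (e\<^sub>r + e\<^sub>s)\<close>, because \<open>e\<^sub>r + e\<^sub>s\<close> is the unit.
  The matrices of multiplications form a space of dimension three inside a space of
  dimension nine, and the six listed equations are linear equations that cut it out.
\<close>

lemma bounded_linear_A3_mult: "bounded_linear (A3_mult r s t p1 p2 a)"
proof -
  have "linear (A3_mult r s t p1 p2 a)"
    unfolding A3_mult_def
    by (intro linearI)
      (simp_all add: algebra_simps sum.distrib scaleR_sum_right)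
  then show ?thesis
    by (simp add: linear_conv_bounded_linear)
qed

lemma algebrizable_on_iff_deriv_A3_mult:
  "algebrizable_on (A3_mult r s t p1 p2) F \<Omega> \<longleftrightarrow>
    (\<forall>w\<in>\<Omega>. \<exists>a. (F has_derivative A3_mult r s t p1 p2 a) (at w))"
proof -
  have "((\<lambda>\<xi>. norm (F (w + \<xi>) - F w - A3_mult r s t p1 p2 a \<xi>) / norm \<xi>) \<longlongrightarrow> 0) (at 0)
      \<longleftrightarrow> (F has_derivative A3_mult r s t p1 p2 a) (at w)" for w a
    by (simp add: has_derivative_at bounded_linear_A3_mult)
  then show ?thesis
    unfolding algebrizable_on_def by (simp add: bchoice_iff)
qed

lemma pderiv_comp_eq_deriv_axis:
  assumes "(F has_derivative D) (at w)"
  shows "pderiv_comp F i j w = D (axis j 1) $ i"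
proof -
  interpret D: bounded_linear D
    using assms by (rule has_derivative_bounded_linear)
  have line: "((\<lambda>u. w + u *\<^sub>R axis j 1) has_derivative (\<lambda>u. u *\<^sub>R axis j 1)) (at (0::real))"
    by (auto intro!: derivative_eq_intros)
  have "((\<lambda>u. F (w + u *\<^sub>R axis j 1)) has_derivative (\<lambda>u. D (u *\<^sub>R axis j 1))) (at 0)"
    using has_derivative_compose[OF line] assms by simp
  then have "((\<lambda>u. F (w + u *\<^sub>R axis j 1) $ i) has_derivative
      (\<lambda>u. D (u *\<^sub>R axis j 1) $ i)) (at 0)"
    by (rule bounded_linear.has_derivative[OF bounded_linear_vec_nth])
  then have "((\<lambda>u. F (w + u *\<^sub>R axis j 1) $ i) has_field_derivative D (axis j 1) $ i) (at 0)"
    by (simp add: has_field_derivative_def D.scaleR mult_commute_abs)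
  then show ?thesis
    unfolding pderiv_comp_def by (rule DERIV_imp_deriv)
qed

lemma linear_eq_iff_on_axes:
  fixes f g :: "real ^ 3 \<Rightarrow> real ^ 3"
  assumes "{r, s, t} = {1, 2, 3}" "linear f" "linear g"
  shows "f = g \<longleftrightarrow>
    f (axis r 1) = g (axis r 1) \<and> f (axis s 1) = g (axis s 1) \<and> f (axis t 1) = g (axis t 1)"
proof -
  have U: "(UNIV :: 3 set) = {r, s, t}"
    using assms(1) UNIV_3 by simp
  have "f = g" if "\<forall>i\<in>UNIV. f (axis i 1) = g (axis i 1)"
    using linear_eq_stdbasis[OF assms(2,3)] that by (auto simp: Basis_vec_def)
  then show ?thesis
    unfolding U by auto
qed

text \<open>
  The only possible multiplier is the image of the unit.  Given the six equations,
  that image has coordinates \<open>D\<^sub>r\<^sub>r\<close>, \<open>D\<^sub>s\<^sub>s\<close> and \<open>D\<^sub>t\<^sub>s\<close>: the coordinates at \<open>s\<close> and \<open>t\<close>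
  receive nothing from \<open>D e\<^sub>r\<close>, and the coordinate at \<open>r\<close> nothing from \<open>D e\<^sub>s\<close>.
\<close>

lemma linear_eq_A3_mult_iff:
  fixes D :: "real ^ 3 \<Rightarrow> real ^ 3"
  assumes rst: "{r, s, t} = {1, 2, 3}" and D: "linear D"
  shows "(\<exists>a. D = A3_mult r s t p1 p2 a) \<longleftrightarrow>
    D (axis s 1) $ r = 0 \<and>
    D (axis r 1) $ s = 0 \<and>
    D (axis t 1) $ s = p1 * D (axis s 1) $ t \<and>
    D (axis t 1) $ r = 0 \<and>
    D (axis r 1) $ t = 0 \<and>
    D (axis t 1) $ t = D (axis s 1) $ s + p2 * D (axis s 1) $ t" (is "?L \<longleftrightarrow> ?R")
proof -
  note d = index3_distinct[OF rst] index3_distinct[OF rst, symmetric]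
  have eq: "D = A3_mult r s t p1 p2 a \<longleftrightarrow>
      (D (axis r 1) $ r = a $ r \<and> D (axis r 1) $ s = 0 \<and> D (axis r 1) $ t = 0) \<and>
      (D (axis s 1) $ r = 0 \<and> D (axis s 1) $ s = a $ s \<and> D (axis s 1) $ t = a $ t) \<and>
      (D (axis t 1) $ r = 0 \<and> D (axis t 1) $ s = p1 * a $ t \<and>
        D (axis t 1) $ t = a $ s + p2 * a $ t)" for a
    using d
    by (simp add: linear_eq_iff_on_axes[OF rst D bounded_linear.linear[OF bounded_linear_A3_mult]]
        A3_vec_eq_iff[OF rst] A3_mult_components[OF rst] axis_def)
  show ?thesis
  proof
    assume ?L
    then show ?R
      unfolding eq by auto
  next
    assume ?R
    then have "D = A3_mult r s t p1 p2 (D (axis r 1 + axis s 1))"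
      unfolding eq by (simp add: linear_add[OF D])
    then show ?L ..
  qed
qed

theorem theorem2p4:
  fixes r s t :: 3
    and p1 p2 :: real
    and F :: "real ^ 3 \<Rightarrow> real ^ 3"
    and \<Omega> :: "(real ^ 3) set"
  assumes "{r, s, t} = {1, 2, 3}"
    and "open \<Omega>"
    and "\<forall>w\<in>\<Omega>. F differentiable (at w)"
  shows "(\<forall>w\<in>\<Omega>.
            pderiv_comp F r s w = 0 \<and>
            pderiv_comp F s r w = 0 \<and>
            pderiv_comp F s t w = p1 * pderiv_comp F t s w \<and>
            pderiv_comp F r t w = 0 \<and>
            pderiv_comp F t r w = 0 \<and>
            pderiv_comp F t t w = pderiv_comp F s s w + p2 * pderiv_comp F t s w)
         \<longleftrightarrow> algebrizable_on (A3_mult r s t p1 p2) F \<Omega>"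
  unfolding algebrizable_on_iff_deriv_A3_mult
proof (rule ball_cong[OF refl])
  fix w
  assume "w \<in> \<Omega>"
  then obtain D where D: "(F has_derivative D) (at w)"
    using assms(3) by (auto simp: differentiable_def)
  have "(F has_derivative A3_mult r s t p1 p2 a) (at w) \<longleftrightarrow> D = A3_mult r s t p1 p2 a" for a
    using D has_derivative_unique by blast
  then show "(pderiv_comp F r s w = 0 \<and>
            pderiv_comp F s r w = 0 \<and>
            pderiv_comp F s t w = p1 * pderiv_comp F t s w \<and>
            pderiv_comp F r t w = 0 \<and>
            pderiv_comp F t r w = 0 \<and>
            pderiv_comp F t t w = pderiv_comp F s s w + p2 * pderiv_comp F t s w)
         \<longleftrightarrow> (\<exists>a. (F has_derivative A3_mult r s t p1 p2 a) (at w))"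
    by (simp add: pderiv_comp_eq_deriv_axis[OF D]
        linear_eq_A3_mult_iff[OF assms(1) has_derivative_linear[OF D]])
qed

end
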